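(* Let $A\in\mathbb{R}^{m\times n}$, $\bm{b}\in\mathbb{R}^m$ and $\sigma\ge0$ be such that $\{\bm{x}\in\mathbb{R}^n:\|A\bm{x}-\bm{b}\|_1\le\sigma\}\ne\emptyset$ and $\|\bm{b}\|_1>\sigma$. There exists a $p^*\in(0,1]$ such that ${\rm SOL}(A,\bm{b},\sigma,p,1)\subseteq{\rm SOL}(A,\bm{b},\sigma,0,1)$ for any $p\in(0,p^* )$. Moreover, there exists a $\overline{p}\in(0,p^* )$ such that ${\rm SOL}(A,\bm{b},\sigma,p,1)={\rm SOL}(A,\bm{b},\sigma,\overline{p},1)$ for any $p\in(0,\overline{p}]$.
   Context: For $0<p\le 1$, $\|\bm{x}\|_p^p:=\sum_{i=1}^n|x_i|^p$; for $p=0$, $\|\bm{x}\|_p^p$ means $\|\bm{x}\|_0$, the number of nonzero entries of $\bm{x}$. For $0\le p\le1$, ${\rm SOL}(A,\bm{b},\sigma,p,1)$ denotes the set of (global) optimal solutions of $$\min_{\bm{x}\in\mathbb{R}^n}\ \|\bm{x}\|_p^p\quad\text{s.t.}\quad\|A\bm{x}-\bm{b}\|_1\le\sigma .$$ *)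

theory Defs
  imports "HOL-Analysis.Analysis"
begin

definition l1_norm :: "real ^ 'k \<Rightarrow> real" where
  "l1_norm x = (\<Sum>i\<in>UNIV. \<bar>x $ i\<bar>)"

definition l0_norm :: "real ^ 'k \<Rightarrow> nat" where
  "l0_norm x = card {i. x $ i \<noteq> 0}"

(* The objective ||x||_p^p, meant for 0 <= p <= 1. The convention 0 powr p = 0
   agrees with 0^p = 0 for p > 0. *)
definition lp_pow :: "real \<Rightarrow> real ^ 'k \<Rightarrow> real" where
  "lp_pow p x = (if p = 0 then real (l0_norm x) else (\<Sum>i\<in>UNIV. \<bar>x $ i\<bar> powr p))"

definition feasible :: "real ^ 'n ^ 'm \<Rightarrow> real ^ 'm \<Rightarrow> real \<Rightarrow> (real ^ 'n) set" where
  "feasible A b \<sigma> = {x. l1_norm (A *v x - b) \<le> \<sigma>}"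

(* SOL(A, b, sigma, p, 1); the last argument 1, the norm in the constraint, is fixed. *)
definition SOL :: "real ^ 'n ^ 'm \<Rightarrow> real ^ 'm \<Rightarrow> real \<Rightarrow> real \<Rightarrow> (real ^ 'n) set" where
  "SOL A b \<sigma> p =
     {x \<in> feasible A b \<sigma>. \<forall>y \<in> feasible A b \<sigma>. lp_pow p x \<le> lp_pow p y}"

end

theory Submission
  imports Defs "HOL-Complex_Analysis.Conformal_Mappings"
begin

text \<open>
  Suppose two points \<open>x \<noteq> y\<close> of the feasible set have the same sign pattern, and the residuals
  \<open>A x - b\<close> and \<open>A y - b\<close> have the same sign pattern as well. If the residual of \<open>x\<close> is not larger than
  that of \<open>y\<close>, then a small symmetric segment around \<open>x\<close> in direction \<open>x - y\<close> is feasible, and strict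
  concavity of \<open>t \<mapsto> t^p\<close> shows that \<open>x\<close> is optimal for no \<open>p \<in> (0,1)\<close>. Hence the solutions for all
  \<open>p \<in> (0,1)\<close> together form a finite set. For fixed \<open>x\<close>, the objective is an exponential sum in \<open>p\<close>,
  so by analyticity any two of these finitely many points are compared in the same way for
  all small \<open>p > 0\<close>. Letting \<open>p\<close> tend to 0 compares them with a sparsest feasible point.
\<close>

section \<open>Strict concavity of powers and local linearity of the l1 norm\<close>

lemma powr_midpoint_strict_concave:
  fixes u v p :: real
  assumes p: "0 < p" "p < 1" and u: "0 < u" and v: "0 < v" and "u \<noteq> v"
  shows "u powr p + v powr p < 2 * ((u + v) / 2) powr p"
proof -
  have *: "u powr p + v powr p < 2 * ((u + v) / 2) powr p" if "0 < u" "u < v" for u v :: real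
  proof -
    define m where "m = (u + v) / 2"
    have m: "u < m" "m < v" "m - u = v - m" using that by (auto simp: m_def field_simps)
    have der: "((\<lambda>x. x powr p) has_real_derivative p * x powr (p - 1)) (at x)" if "u \<le> x" for x
      using that \<open>0 < u\<close> by (intro has_real_derivative_powr) simp
    \<comment> \<open>Both halves of the interval have the same length, and the derivative
      \<open>p * x powr (p - 1)\<close> is strictly decreasing because \<open>p < 1\<close>, so the
      left half has the larger increment.\<close>
    obtain z where z: "u < z" "z < m" "m powr p - u powr p = (m - u) * (p * z powr (p - 1))"
      using MVT2[OF m(1), of "\<lambda>x. x powr p" "\<lambda>x. p * x powr (p - 1)"] der by blast
    obtain w where w: "m < w" "w < v" "v powr p - m powr p = (v - m) * (p * w powr (p - 1))"
      using MVT2[OF m(2), of "\<lambda>x. x powr p" "\<lambda>x. p * x powr (p - 1)"] der m(1) by auto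
    have "w powr (p - 1) < z powr (p - 1)"
      using p z(1,2) w(1,2) m that by (intro powr_less_mono2_neg) auto
    then have "v powr p - m powr p < m powr p - u powr p"
      unfolding z w m(3) using m p by auto
    then show ?thesis by (simp add: m_def)
  qed
  show ?thesis
    using *[of u v] *[of v u] assms by (cases "u < v") (auto simp: add.commute)
qed

text \<open>A small step away from \<open>c\<close> keeps the sign of \<open>a\<close>, and the
  absolute value is linear on each sign class. If \<open>a = 0\<close>, then \<open>c = 0\<close> as
  well and nothing moves.\<close>

lemma eventually_abs_add_same_sign:
  fixes a c :: real
  assumes "sgn a = sgn c"
  shows "\<forall>\<^sub>F t in at_right 0. \<bar>a + t * (a - c)\<bar> = \<bar>a\<bar> + t * (\<bar>a\<bar> - \<bar>c\<bar>)"
proof (cases "a = 0")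
  case True
  then show ?thesis using assms by (simp add: sgn_0_0 eq_commute[of 0])
next
  case False
  have "((\<lambda>t. sgn a * (a + t * (a - c))) \<longlongrightarrow> sgn a * (a + 0 * (a - c))) (at_right 0)"
    by (intro tendsto_intros)
  moreover have "0 < sgn a * (a + 0 * (a - c))" using False by (simp add: sgn_if)
  ultimately have "\<forall>\<^sub>F t in at_right 0. 0 < sgn a * (a + t * (a - c))"
    by (rule order_tendstoD)
  then show ?thesis
    by eventually_elim (use assms False in \<open>auto simp: sgn_if abs_if algebra_simps split: if_splits\<close>)
qed

text \<open>Within one sign pattern the l1 norm is linear. This gives its exact change when the
  segment from \<open>s\<close> to \<open>r\<close> is prolonged slightly beyond \<open>r\<close>,
  where convexity alone would only bound it from below.\<close>

lemma eventually_l1_norm_same_sign: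
  fixes r s :: "real ^ 'k"
  assumes "\<And>i. sgn (r $ i) = sgn (s $ i)"
  shows "\<forall>\<^sub>F t in at_right 0. l1_norm (r + t *\<^sub>R (r - s)) = l1_norm r + t * (l1_norm r - l1_norm s)"
proof -
  have "\<forall>\<^sub>F t in at_right 0. \<forall>i. \<bar>r $ i + t * (r $ i - s $ i)\<bar> = \<bar>r $ i\<bar> + t * (\<bar>r $ i\<bar> - \<bar>s $ i\<bar>)"
    by (intro eventually_all_finite eventually_abs_add_same_sign assms)
  then show ?thesis
    by eventually_elim
      (simp add: l1_norm_def sum.distrib sum_subtractf right_diff_distrib sum_distrib_left)
qed

lemma l1_norm_convex:
  assumes "0 \<le> t" "t \<le> 1"
  shows "l1_norm ((1 - t) *\<^sub>R r + t *\<^sub>R s) \<le> (1 - t) * l1_norm r + t * l1_norm s"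
proof -
  have "l1_norm ((1 - t) *\<^sub>R r + t *\<^sub>R s) \<le> (\<Sum>i\<in>UNIV. (1 - t) * \<bar>r $ i\<bar> + t * \<bar>s $ i\<bar>)"
    unfolding l1_norm_def
  proof (rule sum_mono)
    fix i
    show "\<bar>((1 - t) *\<^sub>R r + t *\<^sub>R s) $ i\<bar> \<le> (1 - t) * \<bar>r $ i\<bar> + t * \<bar>s $ i\<bar>"
      using abs_triangle_ineq[of "(1 - t) * r $ i" "t * s $ i"] assms by (simp add: abs_mult)
  qed
  then show ?thesis by (simp add: l1_norm_def sum.distrib sum_distrib_left)
qed

text \<open>Where \<open>h $ i\<close> is nonzero, it is too small to flip the sign of
  \<open>x $ i\<close>, so the absolute value of \<open>x $ i\<close> is the mean of the two shifted
  ones and strict concavity of the power applies. The other coordinates give equality, and some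
  coordinate is strict since \<open>h\<close> is nonzero.\<close>

lemma lp_pow_midpoint_strict_concave:
  fixes x h :: "real ^ 'n"
  assumes p: "0 < p" "p < 1" and "h \<noteq> 0"
    and small: "\<And>i. h $ i = 0 \<or> \<bar>h $ i\<bar> < \<bar>x $ i\<bar>"
  shows "lp_pow p (x + h) + lp_pow p (x - h) < 2 * lp_pow p x"
proof -
  have strict: "\<bar>(x + h) $ i\<bar> powr p + \<bar>(x - h) $ i\<bar> powr p < 2 * \<bar>x $ i\<bar> powr p"
    if "h $ i \<noteq> 0" for i
  proof -
    have lt: "\<bar>h $ i\<bar> < \<bar>x $ i\<bar>" using small that by blast
    have "(\<bar>(x + h) $ i\<bar> + \<bar>(x - h) $ i\<bar>) / 2 = \<bar>x $ i\<bar>"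
      using lt by (auto simp: abs_if split: if_splits)
    moreover have "0 < \<bar>(x + h) $ i\<bar>" "0 < \<bar>(x - h) $ i\<bar>" "\<bar>(x + h) $ i\<bar> \<noteq> \<bar>(x - h) $ i\<bar>"
      using lt that by (auto simp: abs_if split: if_splits)
    ultimately show ?thesis
      using powr_midpoint_strict_concave[OF p, of "\<bar>(x + h) $ i\<bar>" "\<bar>(x - h) $ i\<bar>"] by simp
  qed
  obtain j where "h $ j \<noteq> 0" using \<open>h \<noteq> 0\<close> by (auto simp: vec_eq_iff)
  have "(\<Sum>i\<in>UNIV. \<bar>(x + h) $ i\<bar> powr p + \<bar>(x - h) $ i\<bar> powr p) < (\<Sum>i\<in>UNIV. 2 * \<bar>x $ i\<bar> powr p)"
  proof (rule sum_strict_mono_ex1)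
    show "\<forall>i\<in>UNIV. \<bar>(x + h) $ i\<bar> powr p + \<bar>(x - h) $ i\<bar> powr p \<le> 2 * \<bar>x $ i\<bar> powr p"
    proof
      fix i
      show "\<bar>(x + h) $ i\<bar> powr p + \<bar>(x - h) $ i\<bar> powr p \<le> 2 * \<bar>x $ i\<bar> powr p"
        using strict[of i] by (cases "h $ i = 0") auto
    qed
    show "\<exists>i\<in>UNIV. \<bar>(x + h) $ i\<bar> powr p + \<bar>(x - h) $ i\<bar> powr p < 2 * \<bar>x $ i\<bar> powr p"
      using strict \<open>h $ j \<noteq> 0\<close> by blast
  qed simp
  then show ?thesis using p by (simp add: lp_pow_def sum.distrib sum_distrib_left)
qed

section \<open>Finiteness of the set of all solutions for exponents in (0,1)\<close>

lemma not_in_SOL_same_sign: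
  fixes A :: "real ^ 'n ^ 'm"
  assumes p: "0 < p" "p < 1" and xF: "x \<in> feasible A b \<sigma>" and yF: "y \<in> feasible A b \<sigma>"
    and "x \<noteq> y"
    and sx: "\<And>i. sgn (x $ i) = sgn (y $ i)"
    and sr: "\<And>j. sgn ((A *v x - b) $ j) = sgn ((A *v y - b) $ j)"
    and le: "l1_norm (A *v x - b) \<le> l1_norm (A *v y - b)"
  shows "x \<notin> SOL A b \<sigma> p"
proof
  assume opt: "x \<in> SOL A b \<sigma> p"
  define d r s where "d = x - y" and "r = A *v x - b" and "s = A *v y - b"
  have small: "\<forall>\<^sub>F t in at_right 0. \<forall>i. (t *\<^sub>R d) $ i = 0 \<or> \<bar>(t *\<^sub>R d) $ i\<bar> < \<bar>x $ i\<bar>"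
  proof (intro eventually_all_finite)
    fix i
    show "\<forall>\<^sub>F t in at_right 0. (t *\<^sub>R d) $ i = 0 \<or> \<bar>(t *\<^sub>R d) $ i\<bar> < \<bar>x $ i\<bar>"
    proof (cases "x $ i = 0")
      case True
      then have "y $ i = 0" using sx[of i] by (simp add: sgn_0_0 eq_commute[of 0])
      then show ?thesis using True by (simp add: d_def)
    next
      case False
      have "((\<lambda>t. \<bar>t * d $ i\<bar>) \<longlongrightarrow> \<bar>0 * d $ i\<bar>) (at_right 0)" by (intro tendsto_intros)
      then have "\<forall>\<^sub>F t in at_right 0. \<bar>t * d $ i\<bar> < \<bar>x $ i\<bar>"
        by (rule order_tendstoD) (use False in simp)
      then show ?thesis by eventually_elim simp
    qed
  qed
  have le1: "\<forall>\<^sub>F t in at_right (0::real). t \<le> 1"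
    by (auto simp: eventually_at_right_field intro!: exI[of _ 1])
  have pos: "\<forall>\<^sub>F t in at_right (0::real). 0 < t" by (simp add: eventually_at_right_less)
  have "\<forall>\<^sub>F t in at_right (0::real). False"
    using small le1 pos eventually_l1_norm_same_sign[OF sr, folded r_def s_def]
  proof eventually_elim
    case (elim t)
    \<comment> \<open>Beyond \<open>x\<close>, on the side away from \<open>y\<close>, the residual
      norm changes with slope \<open>l1_norm r - l1_norm s\<close>, which is nonpositive by
      \<open>le\<close>.\<close>
    have "A *v (x + t *\<^sub>R d) - b = r + t *\<^sub>R (r - s)"
      by (simp add: r_def s_def d_def matrix_vector_right_distrib
          matrix_vector_mult_diff_distrib matrix_vector_mult_scaleR)
    then have "l1_norm (A *v (x + t *\<^sub>R d) - b) = l1_norm r + t * (l1_norm r - l1_norm s)"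
      using elim by simp
    also have "\<dots> \<le> l1_norm r"
      using le elim by (simp add: r_def s_def mult_le_0_iff)
    finally have "x + t *\<^sub>R d \<in> feasible A b \<sigma>"
      using xF by (simp add: feasible_def r_def)
    \<comment> \<open>On the side towards \<open>y\<close> the point is a convex combination of
      \<open>x\<close> and \<open>y\<close>, so convexity of the constraint suffices.\<close>
    moreover have "x - t *\<^sub>R d \<in> feasible A b \<sigma>"
    proof -
      have "A *v (x - t *\<^sub>R d) - b = (1 - t) *\<^sub>R r + t *\<^sub>R s"
        by (simp add: r_def s_def d_def matrix_vector_mult_diff_distrib
            matrix_vector_mult_scaleR algebra_simps)
      then have "l1_norm (A *v (x - t *\<^sub>R d) - b) \<le> (1 - t) * l1_norm r + t * l1_norm s"
        using l1_norm_convex[of t r s] elim by simp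
      also have "\<dots> \<le> \<sigma>"
        using xF yF elim by (intro convex_bound_le) (auto simp: feasible_def r_def s_def)
      finally show ?thesis by (simp add: feasible_def)
    qed
    ultimately have "lp_pow p x \<le> lp_pow p (x + t *\<^sub>R d)" "lp_pow p x \<le> lp_pow p (x - t *\<^sub>R d)"
      using opt by (auto simp: SOL_def)
    moreover have "lp_pow p (x + t *\<^sub>R d) + lp_pow p (x - t *\<^sub>R d) < 2 * lp_pow p x"
      using elim \<open>x \<noteq> y\<close> by (intro lp_pow_midpoint_strict_concave p) (auto simp: d_def)
    ultimately show False by simp
  qed
  then show False by simp
qed

text \<open>Two solutions with the same pair of sign patterns coincide, even if they are optimal for
  different exponents: otherwise the one whose residual norm is not larger would be optimal for no
  exponent in (0,1). There are only finitely many pairs of patterns.\<close>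

lemma finite_UN_SOL:
  fixes A :: "real ^ 'n ^ 'm"
  shows "finite (\<Union>p\<in>{0<..<1}. SOL A b \<sigma> p)" (is "finite ?V")
proof -
  let ?pat = "\<lambda>x. ((\<lambda>i. sgn (x $ i)), (\<lambda>j. sgn ((A *v x - b) $ j)))"
  have inj: "inj_on ?pat ?V"
  proof (rule inj_onI, rule ccontr)
    fix x y
    assume V: "x \<in> ?V" "y \<in> ?V" and eq: "?pat x = ?pat y" and ne: "x \<noteq> y"
    have s: "sgn (x $ i) = sgn (y $ i)" "sgn ((A *v x - b) $ j) = sgn ((A *v y - b) $ j)" for i j
      using eq by (auto simp: fun_eq_iff)
    obtain p q where pq: "0 < p" "p < 1" "x \<in> SOL A b \<sigma> p" "0 < q" "q < 1" "y \<in> SOL A b \<sigma> q"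
      using V by auto
    then have F: "x \<in> feasible A b \<sigma>" "y \<in> feasible A b \<sigma>" by (auto simp: SOL_def)
    show False
    proof (cases "l1_norm (A *v x - b) \<le> l1_norm (A *v y - b)")
      case True
      then show False using not_in_SOL_same_sign[OF pq(1,2) F ne s] pq by blast
    next
      case False
      then show False
        using not_in_SOL_same_sign[OF pq(4,5) F(2,1) ne[symmetric] s[symmetric]] pq by simp
    qed
  qed
  have sgn_range: "sgn a \<in> {-1, 0, 1}" for a :: real by (simp add: sgn_if)
  have "?pat ` ?V \<subseteq> (UNIV \<rightarrow> {-1, 0, 1}) \<times> (UNIV \<rightarrow> {-1, 0, 1})"
    using sgn_range by blast
  moreover have "finite (((UNIV \<rightarrow> {-1, 0, 1}) :: ('n \<Rightarrow> real) set) \<times> ((UNIV \<rightarrow> {-1, 0, 1}) :: ('m \<Rightarrow> real) set))"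
    using finite_PiE[of "UNIV :: 'n set" "\<lambda>_. {-1, 0, 1 :: real}"]
      finite_PiE[of "UNIV :: 'm set" "\<lambda>_. {-1, 0, 1 :: real}"] by (simp add: PiE_UNIV_domain)
  ultimately have "finite (?pat ` ?V)" by (rule finite_subset)
  then show ?thesis using inj by (rule finite_imageD)
qed

section \<open>Existence of solutions for positive exponents\<close>

lemma SOL_nonempty:
  fixes A :: "real ^ 'n ^ 'm"
  assumes p: "0 < p" and ne: "feasible A b \<sigma> \<noteq> {}"
  shows "SOL A b \<sigma> p \<noteq> {}"
proof -
  obtain z where z: "z \<in> feasible A b \<sigma>" using ne by blast
  \<comment> \<open>A single term \<open>\<bar>x $ i\<bar> powr p\<close> is at most
    \<open>lp_pow p x\<close>, so every point at least as good as \<open>z\<close> lies in the box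
    of radius \<open>R\<close>.\<close>
  define R where "R = lp_pow p z powr (1 / p)"
  define K where "K = feasible A b \<sigma> \<inter> cbox (\<chi> i. - R) (\<chi> i. R)"
  have inK: "x \<in> K" if "x \<in> feasible A b \<sigma>" "lp_pow p x \<le> lp_pow p z" for x
  proof -
    have "\<bar>x $ i\<bar> \<le> R" for i
    proof -
      have "\<bar>x $ i\<bar> powr p \<le> lp_pow p x"
        using p member_le_sum[of i UNIV "\<lambda>i. \<bar>x $ i\<bar> powr p"] by (simp add: lp_pow_def)
      then have "(\<bar>x $ i\<bar> powr p) powr (1 / p) \<le> R"
        unfolding R_def using that p by (intro powr_mono2) auto
      then show ?thesis using p by (simp add: powr_powr)
    qed
    then show ?thesis using that by (auto simp: K_def mem_box_cart abs_le_iff minus_le_iff)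
  qed
  have "continuous_on UNIV (\<lambda>x. l1_norm (A *v x - b))"
    unfolding l1_norm_def by (intro continuous_intros)
  then have "closed (feasible A b \<sigma>)"
    unfolding feasible_def by (intro closed_Collect_le) auto
  then have "compact K" unfolding K_def by (intro closed_Int_compact compact_cbox)
  moreover have "K \<noteq> {}" using inK[OF z] by auto
  moreover have "continuous_on K (lp_pow p)"
    unfolding lp_pow_def using p by (auto intro!: continuous_intros continuous_on_powr')
  ultimately obtain x where x: "x \<in> K" "\<And>y. y \<in> K \<Longrightarrow> lp_pow p x \<le> lp_pow p y"
    using continuous_attains_inf[of K "lp_pow p"] by blast
  \<comment> \<open>A feasible point outside \<open>K\<close> has a larger value than
    \<open>z\<close>, and \<open>z\<close> itself lies in \<open>K\<close>.\<close>
  have "lp_pow p x \<le> lp_pow p y" if "y \<in> feasible A b \<sigma>" for y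
    using x inK[OF that] x(2)[OF inK[OF z]] by force
  then show ?thesis using x by (auto simp: SOL_def K_def)
qed

section \<open>Behaviour of the objective as the exponent tends to 0\<close>

lemma lp_pow_eq_sum_exp:
  assumes "p \<noteq> 0"
  shows "lp_pow p x = (\<Sum>i | x $ i \<noteq> 0. exp (p * ln \<bar>x $ i\<bar>))"
proof -
  have "(\<Sum>i\<in>UNIV. \<bar>x $ i\<bar> powr p) = (\<Sum>i | x $ i \<noteq> 0. \<bar>x $ i\<bar> powr p)"
    by (intro sum.mono_neutral_right) auto
  then show ?thesis using assms by (simp add: lp_pow_def powr_def)
qed

text \<open>Each coordinate in the support contributes an exponential that tends to 1, so the limit
  counts the support.\<close>

lemma tendsto_lp_pow_0: "((\<lambda>p. lp_pow p x) \<longlongrightarrow> real (l0_norm x)) (at_right 0)"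
proof -
  have "((\<lambda>p. \<Sum>i | x $ i \<noteq> 0. exp (p * ln \<bar>x $ i\<bar>)) \<longlongrightarrow> (\<Sum>i | x $ i \<noteq> 0. exp (0 * ln \<bar>x $ i\<bar>)))
      (at_right 0)"
    by (intro tendsto_intros)
  then have "((\<lambda>p. \<Sum>i | x $ i \<noteq> 0. exp (p * ln \<bar>x $ i\<bar>)) \<longlongrightarrow> real (l0_norm x)) (at_right 0)"
    by (simp add: l0_norm_def)
  moreover have "\<forall>\<^sub>F p in at_right 0. (\<Sum>i | x $ i \<noteq> 0. exp (p * ln \<bar>x $ i\<bar>)) = lp_pow p x"
    using eventually_at_right_less[of 0] by eventually_elim (simp add: lp_pow_eq_sum_exp)
  ultimately show ?thesis by (rule Lim_transform_eventually)
qed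

text \<open>\<open>F\<close> is an entire extension of \<open>f\<close>. Unless it vanishes
  identically, its zeros are isolated, so \<open>f\<close> has no zero on some interval (0,r) and
  keeps its sign there by the intermediate value theorem. The constant \<open>c\<close> is a truth
  value.\<close>

lemma eventually_at_right_0_sign_const:
  fixes f :: "real \<Rightarrow> real" and F :: "complex \<Rightarrow> complex"
  assumes hol: "F holomorphic_on UNIV" and F: "\<And>t. F (of_real t) = of_real (f t)"
  shows "\<exists>c. \<forall>\<^sub>F t in at_right 0. (f t \<le> 0) = c"
proof (cases "\<forall>z. F z = 0")
  case True
  then have "f t = 0" for t using F[of t] by simp
  then show ?thesis by (intro exI[of _ True]) simp
next
  case False
  then obtain w where w: "F w \<noteq> 0" by blast
  obtain r where r: "0 < r" "\<And>z. z \<in> ball 0 r - {0} \<Longrightarrow> F z \<noteq> 0"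
  proof (cases "F 0 = 0")
    case True
    show ?thesis
      by (rule isolated_zeros[OF hol, of 0 w]) (use True w that in auto)
  next
    case False
    have "isCont F 0"
      using holomorphic_on_imp_continuous_on[OF hol] by (simp add: continuous_on_eq_continuous_at)
    then obtain r where "0 < r" "\<And>z. dist 0 z < r \<Longrightarrow> F z \<noteq> 0"
      using continuous_at_avoid[of 0 F 0] False by auto
    then show ?thesis using that by auto
  qed
  have nz: "f t \<noteq> 0" if "0 < t" "t < r" for t
    using r(2)[of "of_real t"] that F[of t] by auto
  have "continuous_on UNIV (\<lambda>t. Re (F (of_real t)))"
    by (intro continuous_intros continuous_on_compose2[OF holomorphic_on_imp_continuous_on[OF hol]])
      auto
  then have "continuous_on UNIV f" by (simp add: F)
  then have conn: "connected (f ` {0<..<r})"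
    by (intro connected_continuous_image) (auto intro: continuous_on_subset)
  have mono: "f t \<le> 0" if "s \<in> {0<..<r}" "t \<in> {0<..<r}" "f s \<le> 0" for s t
  proof (rule ccontr)
    assume "\<not> f t \<le> 0"
    then have "0 \<in> f ` {0<..<r}"
      using connectedD_interval[OF conn, of "f s" "f t" 0] that by simp
    then show False using nz by force
  qed
  have "(f t \<le> 0) = (f (r / 2) \<le> 0)" if "0 < t" "t < r" for t
    using mono[of t "r / 2"] mono[of "r / 2" t] that by auto
  then have "\<forall>\<^sub>F t in at_right 0. (f t \<le> 0) = (f (r / 2) \<le> 0)"
    using \<open>0 < r\<close> unfolding eventually_at_right_field by blast
  then show ?thesis by blast
qed

text \<open>Allowing complex exponents turns the difference of the two exponential sums into an
  entire function, so the comparison cannot oscillate near 0.\<close>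

lemma eventually_lp_pow_le_const:
  "\<exists>c. \<forall>\<^sub>F p in at_right 0. (lp_pow p x \<le> lp_pow p y) = c"
proof -
  let ?E = "\<lambda>x t. (\<Sum>i | x $ i \<noteq> 0. exp (t * ln \<bar>x $ i\<bar>)) :: real"
  have "\<exists>c. \<forall>\<^sub>F t in at_right 0. (?E x t - ?E y t \<le> 0) = c"
    by (rule eventually_at_right_0_sign_const[of
        "\<lambda>z. (\<Sum>i | x $ i \<noteq> 0. exp (z * of_real (ln \<bar>x $ i\<bar>))) - (\<Sum>i | y $ i \<noteq> 0. exp (z * of_real (ln \<bar>y $ i\<bar>)))"
        "\<lambda>t. ?E x t - ?E y t"])
      (auto intro!: holomorphic_intros simp flip: of_real_mult exp_of_real)
  then obtain c where c: "\<forall>\<^sub>F t in at_right 0. (?E x t - ?E y t \<le> 0) = c" by blast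
  have "\<forall>\<^sub>F p in at_right 0. (lp_pow p x \<le> lp_pow p y) = c"
    using c eventually_at_right_less[of 0] by eventually_elim (simp add: lp_pow_eq_sum_exp)
  then show ?thesis by blast
qed

section \<open>Choice of the thresholds \<open>pstar\<close> and \<open>pbar\<close>\<close>

theorem theorem2p2:
  fixes A :: "real ^ 'n ^ 'm" and b :: "real ^ 'm" and \<sigma> :: real
  assumes "\<sigma> \<ge> 0"
    and "feasible A b \<sigma> \<noteq> {}"
    and "l1_norm b > \<sigma>"
  shows "\<exists>pstar\<in>{0<..1}.
           (\<forall>p\<in>{0<..<pstar}. SOL A b \<sigma> p \<subseteq> SOL A b \<sigma> 0) \<and>
           (\<exists>pbar\<in>{0<..<pstar}. \<forall>p\<in>{0<..pbar}. SOL A b \<sigma> p = SOL A b \<sigma> pbar)"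
proof -
  define F where "F = feasible A b \<sigma>"
  define V where "V = (\<Union>p\<in>{0<..<1}. SOL A b \<sigma> p)"
  have finV: "finite V" unfolding V_def by (rule finite_UN_SOL)
  have VF: "V \<subseteq> F" by (auto simp: V_def F_def SOL_def)
  have SOL_V: "SOL A b \<sigma> p \<subseteq> V" if "0 < p" "p < 1" for p using that by (auto simp: V_def)
  obtain z where z: "z \<in> F" "\<And>y. y \<in> F \<Longrightarrow> l0_norm z \<le> l0_norm y"
    using assms(2) ex_has_least_nat[of "\<lambda>x. x \<in> F" _ l0_norm] by (auto simp: F_def)
  have "\<forall>\<^sub>F p in at_right 0. \<forall>x\<in>V. l0_norm z < l0_norm x \<longrightarrow> lp_pow p z < lp_pow p x"
  \<comment> \<open>A strict inequality between the limits at 0 persists for small \<open>p\<close>,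
    and finiteness of \<open>V\<close> gives one threshold for all its points.\<close>
  proof (intro eventually_ball_finite finV ballI)
    fix x
    show "\<forall>\<^sub>F p in at_right 0. l0_norm z < l0_norm x \<longrightarrow> lp_pow p z < lp_pow p x"
    proof (cases "l0_norm z < l0_norm x")
      case True
      then have "\<forall>\<^sub>F p in at_right 0. 0 < lp_pow p x - lp_pow p z"
        by (intro order_tendstoD(1)[OF tendsto_diff[OF tendsto_lp_pow_0 tendsto_lp_pow_0]]) simp
      then show ?thesis by eventually_elim simp
    qed simp
  qed
  then obtain r where r: "0 < r"
    "\<And>p x. \<lbrakk>0 < p; p < r; x \<in> V; l0_norm z < l0_norm x\<rbrakk> \<Longrightarrow> lp_pow p z < lp_pow p x"
    by (auto simp: eventually_at_right_field)
  \<comment> \<open>Below \<open>r\<close>, a point of \<open>V\<close> with more nonzero entries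
    than \<open>z\<close> loses to \<open>z\<close>; the bound 1 keeps \<open>p\<close> in the range
    covered by \<open>V\<close>.\<close>
  define pstar where "pstar = min r 1"
  have sub: "SOL A b \<sigma> p \<subseteq> SOL A b \<sigma> 0" if p: "p \<in> {0<..<pstar}" for p
  proof
    fix x assume x: "x \<in> SOL A b \<sigma> p"
    have "x \<in> V" using x p SOL_V[of p] by (auto simp: pstar_def)
    moreover have "lp_pow p x \<le> lp_pow p z" using x z by (simp add: SOL_def F_def)
    ultimately have "l0_norm x \<le> l0_norm z" using r(2)[of p x] p by (force simp: pstar_def)
    then have "l0_norm x \<le> l0_norm y" if "y \<in> F" for y using z(2)[OF that] by simp
    then show "x \<in> SOL A b \<sigma> 0"
      using \<open>x \<in> V\<close> VF by (auto simp: SOL_def F_def lp_pow_def)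
  qed
  \<comment> \<open>\<open>c x y\<close> is the truth value that the comparison takes for all small
    \<open>p\<close>; its threshold depends on the pair until finiteness of \<open>V\<close> makes
    it uniform.\<close>
  obtain c where c: "\<And>(x :: real ^ 'n) (y :: real ^ 'n). \<forall>\<^sub>F p in at_right 0. (lp_pow p x \<le> lp_pow p y) = c x y"
    using eventually_lp_pow_le_const by metis
  have "\<forall>\<^sub>F p in at_right 0. \<forall>x\<in>V. \<forall>y\<in>V. (lp_pow p x \<le> lp_pow p y) = c x y"
    by (intro eventually_ball_finite finV ballI c)
  then obtain q where q: "0 < q"
    "\<And>p x y. \<lbrakk>0 < p; p < q; x \<in> V; y \<in> V\<rbrakk> \<Longrightarrow> (lp_pow p x \<le> lp_pow p y) = c x y"
    by (auto simp: eventually_at_right_field)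
  \<comment> \<open>The description by \<open>c\<close> does not involve \<open>p\<close>.
    Minimality within \<open>V\<close> is enough, because \<open>V\<close> contains a global
    minimizer \<open>w\<close> for the given \<open>p\<close>.\<close>
  have char: "SOL A b \<sigma> p = {x \<in> V. \<forall>y\<in>V. c x y}" if p: "0 < p" "p < min q 1" for p
  proof -
    obtain w where w: "w \<in> SOL A b \<sigma> p" using SOL_nonempty[of p] p assms(2) by blast
    then have wV: "w \<in> V" using SOL_V p by auto
    have "SOL A b \<sigma> p = {x \<in> V. \<forall>y\<in>V. lp_pow p x \<le> lp_pow p y}"
    proof (intro subset_antisym subsetI)
      fix x assume "x \<in> SOL A b \<sigma> p"
      then show "x \<in> {x \<in> V. \<forall>y\<in>V. lp_pow p x \<le> lp_pow p y}"
        using SOL_V[of p] p VF by (auto simp: SOL_def F_def)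
    next
      fix x assume "x \<in> {x \<in> V. \<forall>y\<in>V. lp_pow p x \<le> lp_pow p y}"
      then show "x \<in> SOL A b \<sigma> p"
        using w wV VF by (force simp: SOL_def F_def)
    qed
    then show ?thesis using q(2)[of p] p by auto
  qed
  \<comment> \<open>Halving puts \<open>pbar\<close> strictly below both \<open>pstar\<close> and
    \<open>q\<close>, so \<open>char\<close> also covers the endpoint
    \<open>p = pbar\<close>.\<close>
  define pbar where "pbar = min pstar q / 2"
  have pbar: "pbar \<in> {0<..<pstar}" "pbar < min q 1" "pstar \<in> {0<..1}"
    using \<open>0 < r\<close> \<open>0 < q\<close> by (auto simp: pbar_def pstar_def)
  have "SOL A b \<sigma> p = SOL A b \<sigma> pbar" if "p \<in> {0<..pbar}" for p
    using char[of p] char[of pbar] that pbar by auto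
  then show ?thesis using sub pbar by blast
qed

end
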